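(* Let $p\ge 2$ be an integer, and let $\tau:\mathbb{Z}^+\to\mathbb{R}$ be an arbitrary increasing function with $\lim_{n\to\infty}\tau(n)=\infty$. Then there exists a multiplicative semigroup $S_\tau$ of $\mathbb{Z}^+$ containing $p$ and satisfying: (1) $|S_\tau\cap[1,n]|\leq(\log_p n)^{\tau(n)}$ for every positive integer $n$; (2) the Lebesgue measure is the only non-atomic ergodic $\times p$-invariant measure on $\mathbb{T}$ which is $\times q$-invariant for all $q$ in $S_\tau$. In particular, there exists a multiplicative semigroup $S$ of $\mathbb{Z}^+$ containing $p$ and satisfying: (1') $\lim_{n\to\infty}\frac{\log|S\cap[1,n]|}{\log n}=0$; (2') the Lebesgue measure is the only non-atomic ergodic $\times p$-invariant measure on $\mathbb{T}$ which is $\times q$-invariant for all $q$ in $S$.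
   Context: $\mathbb{Z}^+$ is the set of positive integers, $[1,n]=\{1,\dots,n\}$, and $|F|$ denotes the cardinality of a set $F$. A multiplicative semigroup of $\mathbb{Z}^+$ is a subset of $\mathbb{Z}^+$ closed under multiplication. $\mathbb{T}=\mathbb{R}/\mathbb{Z}$ is the unit circle. "Measure" always means Borel probability measure; Lebesgue measure is the normalized one on $\mathbb{T}$. A measure $\mu$ is non-atomic if $\mu\{x\}=0$ for every point $x$. For an integer $q$ the $\times q$ map is $T_q:\mathbb{T}\to\mathbb{T}$, $T_q(x)=qx\bmod\mathbb{Z}$; a measure $\mu$ is $\times q$-invariant if $\mu(T_q^{-1}B)=\mu(B)$ for all Borel $B$. A $\times p$-invariant measure $\mu$ is ergodic if every Borel $B$ with $T_p^{-1}B=B$ satisfies $\mu(B)^2=\mu(B)$.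
   Formalization: Bound (1) is required only at those n where the positive powers of p alone satisfy it (in particular whenever τ(n) ≥ 1), since as printed it fails for every S containing p, e.g. at n = p² if τ(p²) < 1. *)

theory Defs
  imports "HOL-Probability.Probability"
begin

quotient_type circle = real / "\<lambda>x y :: real. x - y \<in> \<int>"
proof (rule equivpI)
  show "reflp (\<lambda>x y :: real. x - y \<in> \<int>)"
    by (simp add: reflp_def)
  show "symp (\<lambda>x y :: real. x - y \<in> \<int>)"
    by (auto simp: symp_def) (metis Ints_minus minus_diff_eq)
  show "transp (\<lambda>x y :: real. x - y \<in> \<int>)"
    by (auto simp: transp_def) (metis Ints_add diff_add_cancel add_diff_eq)
qed

text \<open>The constant \<^const>\<open>abs_circle\<close> is the projection of the reals onto the reals modulo
  the integers; the circle carries the quotient topology, and \<^const>\<open>borel\<close> at this type is its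
  Borel sigma-algebra.\<close>

instantiation circle :: topological_space
begin

definition open_circle :: "circle set \<Rightarrow> bool" where
  "open_circle U \<longleftrightarrow> open (abs_circle -` U)"

instance
proof
  show "open (UNIV :: circle set)"
    by (simp add: open_circle_def)
  show "open (U \<inter> V)" if "open U" "open V" for U V :: "circle set"
    using that by (simp add: open_circle_def vimage_Int open_Int)
  show "open (\<Union>K)" if "\<forall>U\<in>K. open U" for K :: "circle set set"
    using that by (auto simp: open_circle_def vimage_Union)
qed

end

lift_definition times_map :: "int \<Rightarrow> circle \<Rightarrow> circle" is "\<lambda>q x. real_of_int q * x"
  by (metis Ints_mult Ints_of_int right_diff_distrib)

definition borel_probability :: "circle measure \<Rightarrow> bool" where
  "borel_probability \<mu> \<longleftrightarrow> sets \<mu> = sets borel \<and> prob_space \<mu>"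

definition lebesgue_circle :: "circle measure" where
  "lebesgue_circle = distr (restrict_space lborel {0..<1}) borel abs_circle"

definition non_atomic :: "circle measure \<Rightarrow> bool" where
  "non_atomic \<mu> \<longleftrightarrow> (\<forall>x. measure \<mu> {x} = 0)"

definition times_invariant :: "int \<Rightarrow> circle measure \<Rightarrow> bool" where
  "times_invariant q \<mu> \<longleftrightarrow>
     (\<forall>B\<in>sets borel. measure \<mu> (times_map q -` B) = measure \<mu> B)"

definition times_ergodic :: "int \<Rightarrow> circle measure \<Rightarrow> bool" where
  "times_ergodic p \<mu> \<longleftrightarrow>
     (\<forall>B\<in>sets borel. times_map p -` B = B \<longrightarrow> (measure \<mu> B)\<^sup>2 = measure \<mu> B)"

text \<open>A semigroup need not contain 1.\<close>

definition mult_semigroup :: "nat set \<Rightarrow> bool" where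
  "mult_semigroup S \<longleftrightarrow> S \<subseteq> {1..} \<and> (\<forall>a\<in>S. \<forall>b\<in>S. a * b \<in> S)"

definition only_lebesgue :: "nat \<Rightarrow> nat set \<Rightarrow> bool" where
  "only_lebesgue p S \<longleftrightarrow>
     (\<forall>\<mu>. (borel_probability \<mu> \<and> non_atomic \<mu> \<and> times_invariant (int p) \<mu> \<and>
            times_ergodic (int p) \<mu> \<and> (\<forall>q\<in>S. times_invariant (int q) \<mu>))
          \<longleftrightarrow> \<mu> = lebesgue_circle)"

text \<open>Every semigroup containing \<open>p\<close> contains the positive powers of \<open>p\<close>.  So a bound
  \<open>card (S \<inter> {1..n}) \<le> (log p n) powr (\<tau> n)\<close> can hold at \<open>n\<close> only if these powers
  already satisfy it, which fails for instance at \<open>n = p\<^sup>2\<close> when \<open>\<tau> n < 1\<close>.  A function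
  tending to infinity may take such values at finitely many places; the predicate below singles out
  the \<open>n\<close> at which the bound is not excluded for this reason.  It holds wherever \<open>\<tau> n \<ge> 1\<close>.\<close>

definition attainable :: "nat \<Rightarrow> (nat \<Rightarrow> real) \<Rightarrow> nat \<Rightarrow> bool" where
  "attainable p \<tau> n \<longleftrightarrow>
     real (card ({p ^ k |k. k \<ge> 1} \<inter> {1..n})) \<le> log (real p) (real n) powr \<tau> n"

lemma attainable_if_bound:
  assumes "mult_semigroup S" "p \<in> S"
    and bound: "real (card (S \<inter> {1..n})) \<le> log (real p) (real n) powr \<tau> n"
  shows "attainable p \<tau> n"
proof -
  have "p ^ Suc k \<in> S" for k
    using assms(1,2) by (induction k) (auto simp: mult_semigroup_def)
  then have "p ^ k \<in> S" if "k \<ge> 1" for k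
    using that by (metis Suc_le_D One_nat_def)
  then have "card ({p ^ k |k. k \<ge> 1} \<inter> {1..n}) \<le> card (S \<inter> {1..n})"
    by (intro card_mono) auto
  with bound show ?thesis
    by (simp add: attainable_def)
qed

lemma attainable_if_ge_1:
  assumes "p \<ge> 2" "n \<ge> 1" "\<tau> n \<ge> 1"
  shows "attainable p \<tau> n"
proof -
  define l where "l = log (real p) (real n)"
  define P where "P = {p ^ k |k. k \<ge> 1} \<inter> {1..n}"
  have l0: "l \<ge> 0"
    using assms by (simp add: l_def)
  have "P \<subseteq> (\<lambda>k. p ^ k) ` {1..nat \<lfloor>l\<rfloor>}"
  proof
    fix x assume "x \<in> P"
    then obtain k where k: "x = p ^ k" "k \<ge> 1" "p ^ k \<le> n"
      by (auto simp: P_def)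
    have "real p ^ k \<le> real n"
      using k(3) by (metis of_nat_le_iff of_nat_power)
    then have "real k \<le> l"
      using assms unfolding l_def by (simp add: le_log_iff powr_realpow)
    then show "x \<in> (\<lambda>k. p ^ k) ` {1..nat \<lfloor>l\<rfloor>}"
      using k by (auto simp: le_nat_floor)
  qed
  then have "card P \<le> card ((\<lambda>k. p ^ k) ` {1..nat \<lfloor>l\<rfloor>})"
    by (intro card_mono) auto
  also have "\<dots> \<le> nat \<lfloor>l\<rfloor>"
    using card_image_le[of "{1..nat \<lfloor>l\<rfloor>}" "\<lambda>k. p ^ k"] by simp
  finally have le: "card P \<le> nat \<lfloor>l\<rfloor>" .
  show ?thesis
  proof (cases "l \<ge> 1")
    case True
    have "real (card P) \<le> l"
      using le l0 by linarith
    also have "\<dots> \<le> l powr \<tau> n"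
      using powr_mono[OF assms(3) True] True by simp
    finally show ?thesis
      by (simp add: attainable_def P_def l_def)
  next
    case False
    then have "card P = 0"
      using le l0 by linarith
    then show ?thesis
      by (simp add: attainable_def P_def)
  qed
qed

end

theory Submission
  imports Defs "HOL-Real_Asymp.Real_Asymp"
begin

text \<open>Write \<open>u(k)\<close> for the \<open>k\<close>-th Fourier coefficient of a measure \<open>\<mu>\<close>, that is, for the integral of the
  character \<open>e\<^sub>k(x) = exp(2 \<pi> i k x)\<close>. If \<open>\<mu>\<close> is invariant under multiplication by \<open>p\<^sup>j + 1\<close>, then
  \<open>u(k)\<close> is the integral of \<open>e\<^sub>k(p\<^sup>j x) e\<^sub>k(x)\<close>, because \<open>k (p\<^sup>j + 1) = k p\<^sup>j + k\<close>. Suppose that this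
  holds for all \<open>j\<close> in intervals \<open>{a..<a + m}\<close> of every length \<open>m\<close>, and average over the interval. The
  averages of \<open>e\<^sub>k(p\<^sup>j x)\<close> converge to \<open>u(k)\<close> in mean by ergodicity, and the starting point
  \<open>a\<close> of the interval does not affect the distance to the limit since \<open>\<mu>\<close> is \<open>\<times>p\<close>-invariant. Hence
  \<open>u(k) = u(k)\<^sup>2\<close>. The value 1 would force \<open>e\<^sub>k = 1\<close> almost everywhere, which a non-atomic measure
  excludes for \<open>k \<noteq> 0\<close>. So all nontrivial coefficients vanish and \<open>\<mu>\<close> is Lebesgue measure
  (\<open>lebesgue_if_invariant_on_blocks\<close>).

  The intervals may lie arbitrarily far out. If their left ends grow fast enough compared to \<open>\<tau>\<close>, the
  semigroup generated by \<open>p\<close> and the numbers \<open>p\<^sup>j + 1\<close> has so few generators below \<open>n\<close> that counting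
  exponent vectors gives the required bound (\<open>exists_sparse_semigroup_with_blocks\<close>); below the first
  generator \<open>p\<^sup>j + 1\<close> it consists of the powers of \<open>p\<close> alone, and there the bound is the hypothesis
  \<open>attainable\<close>. The second half of the theorem is the case \<open>\<tau>(n) = sqrt (ln n)\<close>.

  The two analytic tools are a mean ergodic theorem for bounded functions, derived from the maximal
  ergodic inequality (\<open>mean_ergodic_L1\<close>), and the uniqueness of Fourier coefficients, derived from
  the Stone-Weierstrass theorem (\<open>measure_eq_if_fourier_coeffs_eq\<close>). The latter also yields the
  invariance and the ergodicity of Lebesgue measure.\<close>

section \<open>Birkhoff averages of an ergodic transformation\<close>

text \<open>The maximum of the partial sums \<open>g(x) + g(T x) + \<dots> + g(T\<^sup>k\<^sup>-\<^sup>1 x)\<close> over \<open>0 \<le> k \<le> n\<close>. In the recursive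
  form below, the identity behind the maximal ergodic inequality is the defining equation.\<close>

primrec birkhoff_max :: "('a \<Rightarrow> 'a) \<Rightarrow> ('a \<Rightarrow> real) \<Rightarrow> nat \<Rightarrow> 'a \<Rightarrow> real" where
  "birkhoff_max T g 0 x = 0"
| "birkhoff_max T g (Suc n) x = max 0 (g x + birkhoff_max T g n (T x))"

lemma birkhoff_max_nonneg: "0 \<le> birkhoff_max T g n x"
  by (cases n) auto

lemma birkhoff_max_Suc_mono: "birkhoff_max T g n x \<le> birkhoff_max T g (Suc n) x"
proof (induction n arbitrary: x)
  case (Suc n)
  show ?case
    using Suc[of "T x"] unfolding birkhoff_max.simps(2)[of T g n x] birkhoff_max.simps(2)[of T g "Suc n" x]
    by linarith
qed auto

lemma birkhoff_sum_le_max: "(\<Sum>i<n. g ((T ^^ i) x)) \<le> birkhoff_max T g n x"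
proof (induction n arbitrary: x)
  case (Suc n)
  have "(\<Sum>i<Suc n. g ((T ^^ i) x)) = g x + (\<Sum>i<n. g ((T ^^ i) (T x)))"
    by (subst sum.lessThan_Suc_shift) (simp add: funpow_swap1)
  also have "\<dots> \<le> birkhoff_max T g (Suc n) x"
    using Suc[of "T x"] by simp
  finally show ?case .
qed auto

locale measure_preserving = prob_space +
  fixes T :: "'a \<Rightarrow> 'a"
  assumes measurable_T [measurable]: "T \<in> measurable M M"
    and distr_T: "distr M M T = M"
begin

lemma measurable_funpow [measurable]: "T ^^ n \<in> measurable M M"
  by (induction n) (auto intro: measurable_comp[OF _ measurable_T])

lemma distr_funpow: "distr M M (T ^^ n) = M"
proof (induction n)
  case (Suc n)
  have "distr M M (T ^^ Suc n) = distr (distr M M (T ^^ n)) M T"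
    by (subst distr_distr) auto
  with Suc distr_T show ?case by (metis funpow.simps(2))
qed (simp add: distr_id)

lemma integral_funpow:
  fixes f :: "'a \<Rightarrow> 'b::{banach, second_countable_topology}"
  assumes "f \<in> borel_measurable M"
  shows "(\<integral>x. f ((T ^^ n) x) \<partial>M) = (\<integral>x. f x \<partial>M)"
  using integral_distr[OF measurable_funpow assms, of n] by (simp add: distr_funpow)

lemma integrable_T:
  fixes f :: "'a \<Rightarrow> 'b::{banach, second_countable_topology}"
  assumes "integrable M f"
  shows "integrable M (\<lambda>x. f (T x))"
  using integrable_distr[OF measurable_T, of f] assms by (simp add: distr_T)

text \<open>Garsia's argument: where the maximum \<open>m\<^sub>n\<close> is positive, \<open>m\<^sub>n \<le> m\<^sub>n\<^sub>+\<^sub>1 = g + m\<^sub>n \<circ> T\<close>, so there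
  \<open>g\<close> dominates \<open>m\<^sub>n - m\<^sub>n \<circ> T\<close>. Elsewhere this difference is at most 0, and its total integral
  vanishes by invariance.\<close>

lemma maximal_ergodic:
  fixes g :: "'a \<Rightarrow> real"
  assumes g: "integrable M g"
    and pos: "AE x in M. \<exists>n. 0 < birkhoff_max T g n x"
  shows "0 \<le> (\<integral>x. g x \<partial>M)"
proof -
  let ?m = "birkhoff_max T g"
  have int: "integrable M (?m n)" for n
  proof (induction n)
    case (Suc n)
    have "?m (Suc n) = (\<lambda>x. max 0 (g x + ?m n (T x)))" by (rule ext) simp
    then show ?case using g integrable_T[OF Suc] by simp
  qed simp
  have [measurable]: "g \<in> borel_measurable M" "?m n \<in> borel_measurable M" for n
    using g int by auto
  define P where "P n = {x \<in> space M. 0 < ?m n x}" for n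
  have P [measurable]: "P n \<in> sets M" for n
    unfolding P_def by measurable
  have step: "0 \<le> (\<integral>x. indicator (P n) x * g x \<partial>M)" for n
  proof -
    have "0 = (\<integral>x. ?m n x - ?m n (T x) \<partial>M)"
      using int integrable_T[OF int] integral_funpow[of "?m n" 1] by simp
    also have "\<dots> \<le> (\<integral>x. indicator (P n) x * g x \<partial>M)"
    proof (rule integral_mono)
      show "integrable M (\<lambda>x. ?m n x - ?m n (T x))"
        using int integrable_T[OF int] by simp
      show "integrable M (\<lambda>x. indicator (P n) x * g x)"
        using integrable_mult_indicator[OF P g] by simp
      fix x assume x: "x \<in> space M"
      show "?m n x - ?m n (T x) \<le> indicator (P n) x * g x"
      proof (cases "0 < ?m n x")
        case True
        have "?m n x \<le> g x + ?m n (T x)"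
          using birkhoff_max_Suc_mono[of T g n x] True by simp
        then show ?thesis using True x by (simp add: P_def)
      next
        case False
        then show ?thesis
          using birkhoff_max_nonneg[of T g n x] birkhoff_max_nonneg[of T g n "T x"]
          by (simp add: P_def)
      qed
    qed
    finally show ?thesis .
  qed
  have "(\<lambda>n. \<integral>x. indicator (P n) x * g x \<partial>M) \<longlonglongrightarrow> (\<integral>x. g x \<partial>M)"
  proof (rule integral_dominated_convergence[where w = "\<lambda>x. norm (g x)"])
    show "AE x in M. (\<lambda>n. indicator (P n) x * g x) \<longlonglongrightarrow> g x"
      using pos AE_space
    proof eventually_elim
      case (elim x)
      then obtain n where n: "0 < ?m n x" by auto
      have inc: "incseq (\<lambda>n. ?m n x)"
        by (intro incseq_SucI birkhoff_max_Suc_mono)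
      have "indicator (P k) x * g x = g x" if "n \<le> k" for k
        using incseqD[OF inc that] n elim by (simp add: P_def)
      then show ?case
        by (intro tendsto_eventually) (auto simp: eventually_sequentially)
    qed
    show "AE x in M. norm (indicator (P n) x * g x) \<le> norm (g x)" for n
      by (auto simp: indicator_def)
  qed (use g in auto)
  then show ?thesis
    by (rule LIMSEQ_le_const) (use step in auto)
qed

definition birkhoff_avg :: "('a \<Rightarrow> 'b::real_vector) \<Rightarrow> nat \<Rightarrow> 'a \<Rightarrow> 'b" where
  "birkhoff_avg g n x = (\<Sum>i<n. g ((T ^^ i) x)) /\<^sub>R real n"

lemma measurable_birkhoff_avg [measurable]:
  fixes g :: "'a \<Rightarrow> 'b::{real_normed_vector, second_countable_topology}"
  assumes [measurable]: "g \<in> borel_measurable M"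
  shows "birkhoff_avg g n \<in> borel_measurable M"
  unfolding birkhoff_avg_def[abs_def] by measurable

lemma norm_birkhoff_avg_le:
  fixes g :: "'a \<Rightarrow> 'b::real_normed_vector"
  assumes "\<And>x. norm (g x) \<le> C" 
  shows "norm (birkhoff_avg g n x) \<le> C"
proof (cases "n = 0")
  case True
  then show ?thesis using order_trans[OF norm_ge_zero assms] by (simp add: birkhoff_avg_def)
next
  case False
  have "norm (\<Sum>i<n. g ((T ^^ i) x)) \<le> real n * C"
    using sum_norm_bound[of "{..<n}" "\<lambda>i. g ((T ^^ i) x)" C] assms by simp
  then show ?thesis using False by (simp add: birkhoff_avg_def divide_simps mult.commute)
qed

end

locale ergodic_map = measure_preserving +
  assumes ergodic: "\<And>B. B \<in> sets M \<Longrightarrow> T -` B \<inter> space M = B \<Longrightarrow> prob B = 0 \<or> prob B = 1"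
begin

text \<open>The limit superior of the averages takes the same value at \<open>x\<close> and \<open>T x\<close> at every single point, so
  its superlevel sets are strictly invariant and ergodicity applies without discarding a null set. If
  it exceeded \<open>c\<close> almost everywhere, the partial sums of \<open>g - c\<close> would be positive at some time almost
  everywhere, and the maximal inequality would make the mean of \<open>g\<close> at least \<open>c\<close>.\<close>

lemma limsup_birkhoff_avg_le:
  fixes g :: "'a \<Rightarrow> real"
  assumes g [measurable]: "g \<in> borel_measurable M" and bnd: "\<And>x. \<bar>g x\<bar> \<le> C"
    and c: "(\<integral>x. g x \<partial>M) < c"
  shows "AE x in M. limsup (\<lambda>n. ereal (birkhoff_avg g n x)) \<le> ereal c"
proof -
  define E where "E = {x \<in> space M. ereal c < limsup (\<lambda>n. ereal (birkhoff_avg g n x))}"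
  have E [measurable]: "E \<in> sets M"
    unfolding E_def by measurable
  have inv: "limsup (\<lambda>n. ereal (birkhoff_avg g n (T x))) = limsup (\<lambda>n. ereal (birkhoff_avg g n x))" for x
  proof -
    \<comment> \<open>Passing from \<open>x\<close> to \<open>T x\<close> changes only the first and the last summand.\<close>
    let ?r = "\<lambda>n. (g ((T ^^ n) x) - g x) / real n"
    have shift: "birkhoff_avg g n (T x) = ?r n + birkhoff_avg g n x" for n
    proof -
      have "(\<Sum>i<n. g ((T ^^ i) (T x))) + g x = (\<Sum>i<n. g ((T ^^ i) x)) + g ((T ^^ n) x)"
        by (induction n) (auto simp: funpow_swap1)
      then have "(\<Sum>i<n. g ((T ^^ i) (T x))) = (\<Sum>i<n. g ((T ^^ i) x)) + (g ((T ^^ n) x) - g x)"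
        by simp
      then show ?thesis
        unfolding birkhoff_avg_def by (simp add: add_divide_distrib inverse_eq_divide)
    qed
    have "?r \<longlonglongrightarrow> 0"
    proof (rule tendsto_rabs_zero_cancel, rule tendsto_sandwich[of "\<lambda>_. 0"])
      have "\<bar>g y - g x\<bar> \<le> 2 * C" for y using bnd[of y] bnd[of x] by linarith
      then show "\<forall>\<^sub>F n in sequentially. \<bar>?r n\<bar> \<le> 2 * C / real n"
        by (auto intro!: always_eventually divide_right_mono simp: abs_divide)
      show "(\<lambda>n. 2 * C / real n) \<longlonglongrightarrow> 0"
        by (rule lim_const_over_n)
    qed auto
    then have "(\<lambda>n. ereal (?r n)) \<longlonglongrightarrow> ereal 0"
      by (simp add: zero_ereal_def)
    from ereal_limsup_lim_add[OF this, of "\<lambda>n. ereal (birkhoff_avg g n x)"] show ?thesis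
      by (simp add: shift zero_ereal_def[symmetric])
  qed
  have "T -` E \<inter> space M = E"
    unfolding E_def inv using measurable_space[OF measurable_T] by (auto simp: inv)
  then consider "prob E = 0" | "prob E = 1"
    using ergodic[OF E] by blast
  then show ?thesis
  proof cases
    case 1
    then have "AE x in M. x \<notin> E"
      by (intro AE_not_in) (auto simp: null_sets_def emeasure_eq_measure)
    then show ?thesis
      by (rule AE_mp) (auto intro!: AE_I2 simp: E_def not_less)
  next
    case 2
    have int: "integrable M g"
      using bnd by (intro integrable_const_bound[where B = C]) auto
    have "AE x in M. x \<in> E"
      using 2 by (simp add: AE_in_set_eq_1)
    then have "AE x in M. \<exists>n. 0 < birkhoff_max T (\<lambda>x. g x - c) n x"
    proof eventually_elim
      case (elim x)
      \<comment> \<open>The average of length 0 is 0 by convention, so it must not be the witness.\<close>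
      have "\<exists>n\<ge>1. c < birkhoff_avg g n x"
      proof (rule ccontr)
        assume "\<not> ?thesis"
        then have "limsup (\<lambda>n. ereal (birkhoff_avg g n x)) \<le> ereal c"
          by (intro Limsup_bounded) (auto simp: eventually_sequentially not_less intro!: exI[of _ 1])
        with elim show False by (simp add: E_def not_le[symmetric])
      qed
      then obtain n where n: "n \<ge> 1" "c < birkhoff_avg g n x" by auto
      then have "0 < (\<Sum>i<n. g ((T ^^ i) x) - c)"
        by (simp add: birkhoff_avg_def sum_subtractf field_simps)
      also have "\<dots> \<le> birkhoff_max T (\<lambda>x. g x - c) n x"
        by (rule birkhoff_sum_le_max)
      finally show ?case by blast
    qed
    then have "0 \<le> (\<integral>x. g x - c \<partial>M)"
      using int by (intro maximal_ergodic) auto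
    then have False
      using c int by (simp add: prob_space)
    then show ?thesis ..
  qed
qed

text \<open>The lower bound is the upper bound for \<open>- g\<close>.\<close>

lemma birkhoff_avg_tendsto:
  fixes g :: "'a \<Rightarrow> real"
  assumes g [measurable]: "g \<in> borel_measurable M" and bnd: "\<And>x. \<bar>g x\<bar> \<le> C"
  shows "AE x in M. (\<lambda>n. birkhoff_avg g n x) \<longlonglongrightarrow> (\<integral>x. g x \<partial>M)"
proof -
  let ?u = "\<integral>x. g x \<partial>M"
  have bnd': "\<bar>- g x\<bar> \<le> C" for x using bnd[of x] by simp
  have "AE x in M. \<forall>k. limsup (\<lambda>n. ereal (birkhoff_avg g n x)) \<le> ereal (?u + 1 / Suc k)"
    unfolding AE_all_countable
    by (intro allI limsup_birkhoff_avg_le[OF g bnd]) simp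
  moreover have "AE x in M. \<forall>k. limsup (\<lambda>n. ereal (birkhoff_avg (\<lambda>x. - g x) n x)) \<le> ereal (- ?u + 1 / Suc k)"
    unfolding AE_all_countable
    by (intro allI limsup_birkhoff_avg_le[OF _ bnd']) auto
  ultimately show ?thesis
  proof eventually_elim
    case (elim x)
    have neg: "birkhoff_avg (\<lambda>x. - g x) n x = - birkhoff_avg g n x" for n
      by (simp add: birkhoff_avg_def sum_negf)
    show ?case
    proof (rule LIMSEQ_I)
      fix r :: real assume "0 < r"
      then obtain k where k: "1 / Suc k < r"
        by (metis nat_approx_posE)
      have "\<forall>\<^sub>F n in sequentially. ereal (birkhoff_avg g n x) < ereal (?u + r)"
        using elim(1) k by (intro Limsup_lessD) (metis add_strict_left_mono ereal_less(3) less_ereal.simps(1) order_le_less_trans)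
      moreover have "\<forall>\<^sub>F n in sequentially. ereal (birkhoff_avg (\<lambda>x. - g x) n x) < ereal (- ?u + r)"
        using elim(2) k by (intro Limsup_lessD) (metis add_strict_left_mono less_ereal.simps(1) order_le_less_trans)
      ultimately have "\<forall>\<^sub>F n in sequentially. norm (birkhoff_avg g n x - ?u) < r"
        by eventually_elim (auto simp: neg)
      then show "\<exists>no. \<forall>n\<ge>no. norm (birkhoff_avg g n x - ?u) < r"
        by (simp add: eventually_sequentially)
    qed
  qed
qed

lemma mean_ergodic_L1:
  fixes f :: "'a \<Rightarrow> complex"
  assumes f [measurable]: "f \<in> borel_measurable M" and bnd: "\<And>x. norm (f x) \<le> C"
  shows "(\<lambda>n. \<integral>x. norm (birkhoff_avg f n x - (\<integral>x. f x \<partial>M)) \<partial>M) \<longlonglongrightarrow> 0"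
proof -
  let ?u = "\<integral>x. f x \<partial>M"
  have int: "integrable M f"
    using bnd by (intro integrable_const_bound[where B = C]) auto
  have "AE x in M. (\<lambda>n. birkhoff_avg (\<lambda>x. Re (f x)) n x) \<longlonglongrightarrow> Re ?u"
    using birkhoff_avg_tendsto[of "\<lambda>x. Re (f x)" C] bnd int
    by (simp add: integral_Re order_trans[OF abs_Re_le_cmod])
  moreover have "AE x in M. (\<lambda>n. birkhoff_avg (\<lambda>x. Im (f x)) n x) \<longlonglongrightarrow> Im ?u"
    using birkhoff_avg_tendsto[of "\<lambda>x. Im (f x)" C] bnd int
    by (simp add: integral_Im order_trans[OF abs_Im_le_cmod])
  ultimately have lim: "AE x in M. (\<lambda>n. birkhoff_avg f n x) \<longlonglongrightarrow> ?u"
  proof eventually_elim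
    case (elim x)
    then show ?case
      by (simp add: tendsto_complex_iff birkhoff_avg_def)
  qed
  have "(\<lambda>n. \<integral>x. norm (birkhoff_avg f n x - ?u) \<partial>M) \<longlonglongrightarrow> (\<integral>x. 0 \<partial>M)"
  proof (rule integral_dominated_convergence[where w = "\<lambda>_. C + norm ?u"])
    show "AE x in M. (\<lambda>n. norm (birkhoff_avg f n x - ?u)) \<longlonglongrightarrow> 0"
      using lim by eventually_elim (auto intro!: tendsto_norm_zero simp: LIM_zero_iff)
    show "AE x in M. norm (norm (birkhoff_avg f n x - ?u)) \<le> C + norm ?u" for n
    proof (intro AE_I2)
      fix x show "norm (norm (birkhoff_avg f n x - ?u)) \<le> C + norm ?u"
        using norm_triangle_ineq4[of "birkhoff_avg f n x" ?u] norm_birkhoff_avg_le[of f C n x] bnd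
        by simp
    qed
  qed auto
  then show ?thesis by simp
qed

end

section \<open>Characters of the circle\<close>

lift_definition circle_char :: "int \<Rightarrow> circle \<Rightarrow> complex" is "\<lambda>k x. cis (2 * pi * of_int k * x)"
proof -
  fix k :: int and x y :: real
  assume "x - y \<in> \<int>"
  then obtain n where "x = y + of_int n"
    by (metis Ints_cases add_diff_cancel_left' add.commute diff_add_cancel)
  then have "cis (2 * pi * of_int k * x) = cis (2 * pi * of_int k * y) * cis (2 * pi * of_int (k * n))"
    by (simp add: cis_mult algebra_simps)
  also have "cis (2 * pi * of_int (k * n)) = 1"
    by (rule cis_multiple_2pi) simp
  finally show "cis (2 * pi * of_int k * x) = cis (2 * pi * of_int k * y)"
    by simp
qed

lemma abs_circle_exhaust: obtains t where "x = abs_circle t"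
  by (metis Quotient3_abs_rep Quotient3_circle)

lemma circle_char_add: "circle_char (k + l) x = circle_char k x * circle_char l x"
  by transfer (simp add: cis_mult algebra_simps)

lemma circle_char_0 [simp]: "circle_char 0 x = 1"
  by transfer simp

lemma norm_circle_char [simp]: "norm (circle_char k x) = 1"
  by transfer simp

lemma circle_char_times_map: "circle_char k (times_map q x) = circle_char (k * q) x"
  by transfer (simp add: algebra_simps)

lemma circle_char_eq_1_iff: "circle_char k (abs_circle x) = 1 \<longleftrightarrow> of_int k * x \<in> \<int>"
proof -
  have "circle_char k (abs_circle x) = 1 \<longleftrightarrow> cos (2 * pi * of_int k * x) = 1"
    using cos_one_sin_zero by (auto simp: circle_char.abs_eq complex_eq_iff)
  also have "\<dots> \<longleftrightarrow> (\<exists>n::int. 2 * pi * of_int k * x = of_int n * 2 * pi)"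
    by (rule cos_one_2pi_int)
  also have "\<dots> \<longleftrightarrow> (\<exists>n::int. of_int k * x = of_int n)"
    by (simp add: mult.commute mult.left_commute)
  finally show ?thesis by (auto simp: Ints_def)
qed

lemma inj_circle_char_1: "inj (circle_char 1)"
proof (rule injI)
  fix x y :: circle
  assume "circle_char 1 x = circle_char 1 y"
  then show "x = y"
  proof transfer
    fix x y :: real
    assume "cis (2 * pi * of_int 1 * x) = cis (2 * pi * of_int 1 * y)"
    then have "cis (2 * pi * x) / cis (2 * pi * y) = 1"
      by simp
    then have "cis (2 * pi * (x - y)) = 1"
      by (simp add: cis_divide algebra_simps)
    then have "circle_char 1 (abs_circle (x - y)) = 1"
      by (simp add: circle_char.abs_eq)
    then show "x - y \<in> \<int>"
      by (simp add: circle_char_eq_1_iff)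
  qed
qed

lemma times_map_times_map: "times_map q (times_map r x) = times_map (q * r) x"
  by transfer (simp add: algebra_simps)

lemma times_map_funpow: "times_map q ^^ n = times_map (q ^ n)"
proof (induction n)
  case 0
  have "times_map 1 x = x" for x by transfer simp
  then show ?case by auto
qed (auto simp: fun_eq_iff times_map_times_map)

lift_definition circle_rotate :: "real \<Rightarrow> circle \<Rightarrow> circle" is "\<lambda>a x. a + x"
  by simp

lemma circle_char_circle_rotate: "circle_char k (circle_rotate a x) = cis (2 * pi * of_int k * a) * circle_char k x"
  by transfer (simp add: cis_mult algebra_simps)

text \<open>The universal property of the quotient topology.\<close>

lemma continuous_on_circleI:
  fixes f :: "circle \<Rightarrow> 'b::topological_space"
  assumes "continuous_on UNIV (\<lambda>x. f (abs_circle x))"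
  shows "continuous_on UNIV f"
proof -
  have "open (f -` U)" if "open U" for U
    using continuous_on_open_vimage[OF open_UNIV, of "\<lambda>x. f (abs_circle x)"] assms that
    by (simp add: open_circle_def vimage_def)
  then show ?thesis
    by (simp add: continuous_on_open_vimage)
qed

lemma continuous_abs_circle: "continuous_on UNIV abs_circle"
  by (simp add: continuous_on_open_vimage open_circle_def)

lemma continuous_circle_char: "continuous_on UNIV (circle_char k)"
  by (rule continuous_on_circleI) (auto simp: circle_char.abs_eq intro!: continuous_intros)

lemma continuous_times_map: "continuous_on UNIV (times_map q)"
proof (rule continuous_on_circleI)
  show "continuous_on UNIV (\<lambda>x. times_map q (abs_circle x))"
    unfolding times_map.abs_eq
    by (rule continuous_on_compose2[OF continuous_abs_circle]) (auto intro!: continuous_intros)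
qed

lemma continuous_circle_rotate: "continuous_on UNIV (circle_rotate a)"
proof (rule continuous_on_circleI)
  show "continuous_on UNIV (\<lambda>x. circle_rotate a (abs_circle x))"
    unfolding circle_rotate.abs_eq
    by (rule continuous_on_compose2[OF continuous_abs_circle]) (auto intro!: continuous_intros)
qed

lemma borel_measurable_circle [measurable]:
  "circle_char k \<in> borel_measurable borel"
  "times_map q \<in> measurable borel borel"
  "circle_rotate a \<in> measurable borel borel"
  "abs_circle \<in> measurable borel borel"
  using continuous_circle_char continuous_times_map continuous_circle_rotate continuous_abs_circle
  by (auto intro: borel_measurable_continuous_onI)

text \<open>The character \<open>e\<^sub>1\<close> is a homeomorphism onto the complex unit circle; only its closedness is
  recorded. It allows the topology of the complex plane to be used on the quotient.\<close>

lemma closed_image_circle_char_1: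
  assumes "closed C"
  shows "closed (circle_char 1 ` C)"
proof -
  let ?K = "abs_circle -` C \<inter> {0..1}"
  let ?f = "\<lambda>x::real. cis (2 * pi * x)"
  have "closed (abs_circle -` C)"
    using assms by (simp add: closed_def open_circle_def vimage_Compl)
  then have "compact ?K"
    by (intro closed_Int_compact) auto
  moreover have "continuous_on ?K ?f"
    by (intro continuous_intros)
  ultimately have "compact (?f ` ?K)"
    by (rule compact_continuous_image[rotated])
  moreover have "?f ` ?K = circle_char 1 ` C"
  proof
    show "?f ` ?K \<subseteq> circle_char 1 ` C"
      by (auto simp: circle_char.abs_eq intro!: image_eqI[where x = "abs_circle _"])
    show "circle_char 1 ` C \<subseteq> ?f ` ?K"
    proof
      fix z assume "z \<in> circle_char 1 ` C"
      then obtain x where x: "x \<in> C" "z = circle_char 1 x" by auto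
      obtain t where t: "x = abs_circle t" by (rule abs_circle_exhaust)
      have "abs_circle (frac t) = x"
        unfolding t circle.abs_eq_iff by (simp add: frac_def)
      then show "z \<in> ?f ` ?K"
        using x by (intro image_eqI[of _ _ "frac t"])
          (auto simp: circle_char.abs_eq less_imp_le[OF frac_lt_1] simp flip: \<open>abs_circle (frac t) = x\<close>)
    qed
  qed
  ultimately show ?thesis by (simp add: compact_imp_closed)
qed

section \<open>Measures are determined by their Fourier coefficients\<close>

inductive trig_poly :: "(circle \<Rightarrow> complex) \<Rightarrow> bool" where
  char: "trig_poly (circle_char k)"
| add: "trig_poly f \<Longrightarrow> trig_poly g \<Longrightarrow> trig_poly (\<lambda>x. f x + g x)"
| scale: "trig_poly f \<Longrightarrow> trig_poly (\<lambda>x. c * f x)"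

lemma trig_poly_const: "trig_poly (\<lambda>x. c)"
  using trig_poly.scale[OF trig_poly.char[of 0], of c] by simp

lemma trig_poly_mult:
  assumes "trig_poly f" "trig_poly g"
  shows "trig_poly (\<lambda>x. f x * g x)"
  using assms(1)
proof induction
  case (char k)
  show ?case
    using assms(2)
  proof induction
    case (char l)
    have "(\<lambda>x. circle_char k x * circle_char l x) = circle_char (k + l)"
      by (simp add: circle_char_add fun_eq_iff)
    then show ?case by (simp add: trig_poly.char)
  next
    case (add f g)
    then show ?case by (simp add: distrib_left trig_poly.add)
  next
    case (scale f c)
    then show ?case using trig_poly.scale[OF scale.IH, of c] by (simp add: mult.left_commute)
  qed
next
  case (add f h)
  then show ?case by (simp add: distrib_right trig_poly.add)
next
  case (scale f c)
  then show ?case using trig_poly.scale[OF scale.IH, of c] by (simp add: mult.assoc)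
qed

lemma cnj_circle_char: "cnj (circle_char k x) = circle_char (- k) x"
  by transfer (simp add: cis_cnj)

text \<open>On the unit circle the complex conjugate of \<open>z\<close> is \<open>1 / z\<close>, so the coordinates of \<open>e\<^sub>1(x)\<close>, and
  with them every real polynomial in the coordinates, are trigonometric polynomials.\<close>

lemma trig_poly_real_polynomial:
  assumes "real_polynomial_function (g :: complex \<Rightarrow> real)"
  shows "trig_poly (\<lambda>x. of_real (g (circle_char 1 x)))"
  using assms
proof induction
  case (linear f)
  interpret bounded_linear f by fact
  have eq: "of_real (f (circle_char 1 x)) = (of_real (f 1) / 2) * (circle_char 1 x + circle_char (- 1) x)
      + (- \<i> * of_real (f \<i>) / 2) * (circle_char 1 x + (-1) * circle_char (- 1) x)" for x
  proof -
    let ?z = "circle_char 1 x"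
    have "?z = Re ?z *\<^sub>R 1 + Im ?z *\<^sub>R \<i>"
      by (simp add: complex_eq_iff)
    then have "f ?z = Re ?z * f 1 + Im ?z * f \<i>"
      by (metis add scale real_scaleR_def)
    then show ?thesis
      by (simp add: cnj_circle_char[symmetric] complex_eq_iff field_simps)
  qed
  show ?case
    unfolding eq by (intro trig_poly.intros)
next
  case (const c)
  show ?case by (rule trig_poly_const)
next
  case (add f g)
  then show ?case by (simp add: trig_poly.add)
next
  case (mult f g)
  then show ?case by (simp add: trig_poly_mult)
qed

lemma integral_trig_poly_eq:
  assumes "trig_poly f" "finite_measure M" "finite_measure N"
    and [measurable_cong]: "sets M = sets borel" "sets N = sets borel"
    and eq: "\<And>k. (\<integral>x. circle_char k x \<partial>M) = (\<integral>x. circle_char k x \<partial>N)"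
  shows "integrable M f \<and> integrable N f \<and> (\<integral>x. f x \<partial>M) = (\<integral>x. f x \<partial>N)"
  using assms(1)
proof induction
  case (char k)
  interpret M: finite_measure M by fact
  interpret N: finite_measure N by fact
  show ?case
    using eq by (auto intro!: M.integrable_const_bound[where B = 1] N.integrable_const_bound[where B = 1])
qed auto

text \<open>By Stone-Weierstrass, \<open>\<phi>\<close> is uniformly close on the unit circle to a polynomial, and the two
  measures agree on polynomials.\<close>

lemma integral_continuous_eq:
  fixes \<phi> :: "complex \<Rightarrow> real"
  assumes fin: "finite_measure M" "finite_measure N"
    and [measurable_cong]: "sets M = sets borel" "sets N = sets borel"
    and eq: "\<And>k. (\<integral>x. circle_char k x \<partial>M) = (\<integral>x. circle_char k x \<partial>N)"
    and \<phi>: "continuous_on UNIV \<phi>"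
  shows "(\<integral>x. \<phi> (circle_char 1 x) \<partial>M) = (\<integral>x. \<phi> (circle_char 1 x) \<partial>N)"
proof -
  interpret M: finite_measure M by fact
  interpret N: finite_measure N by fact
  have [measurable]: "\<phi> \<in> borel_measurable borel"
    using \<phi> by (rule borel_measurable_continuous_onI)
  have "bounded (\<phi> ` sphere 0 1)"
    by (intro compact_imp_bounded compact_continuous_image continuous_on_subset[OF \<phi>]) auto
  then obtain C where "\<forall>z\<in>sphere 0 1. \<bar>\<phi> z\<bar> \<le> C"
    unfolding bounded_iff by auto
  then have C: "\<bar>\<phi> z\<bar> \<le> C" if "z \<in> sphere 0 1" for z
    using that by blast
  have int: "integrable M (\<lambda>x. \<phi> (circle_char 1 x))" "integrable N (\<lambda>x. \<phi> (circle_char 1 x))"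
    using C by (auto intro!: M.integrable_const_bound[where B = C] N.integrable_const_bound[where B = C])
  let ?d = "\<bar>(\<integral>x. \<phi> (circle_char 1 x) \<partial>M) - (\<integral>x. \<phi> (circle_char 1 x) \<partial>N)\<bar>"
  have "?d \<le> e * (measure M UNIV + measure N UNIV)" if "e > 0" for e
  proof -
    obtain g where g: "real_polynomial_function g" "\<And>z. z \<in> sphere 0 1 \<Longrightarrow> \<bar>\<phi> z - g z\<bar> < e"
      by (rule Stone_Weierstrass_real_polynomial_function[of "sphere 0 1" \<phi> e])
         (use \<open>e > 0\<close> continuous_on_subset[OF \<phi>] in auto)
    have "(\<integral>x. complex_of_real (g (circle_char 1 x)) \<partial>M) = (\<integral>x. complex_of_real (g (circle_char 1 x)) \<partial>N)"
      and gint: "integrable M (\<lambda>x. complex_of_real (g (circle_char 1 x)))"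
        "integrable N (\<lambda>x. complex_of_real (g (circle_char 1 x)))"
      using integral_trig_poly_eq[OF trig_poly_real_polynomial[OF g(1)] assms(1-5)] by auto
    then have same: "(\<integral>x. g (circle_char 1 x) \<partial>M) = (\<integral>x. g (circle_char 1 x) \<partial>N)"
      by simp
    have close: "\<bar>(\<integral>x. \<phi> (circle_char 1 x) \<partial>L) - (\<integral>x. g (circle_char 1 x) \<partial>L)\<bar> \<le> e * measure L UNIV"
      if "integrable L (\<lambda>x. \<phi> (circle_char 1 x))" "integrable L (\<lambda>x. complex_of_real (g (circle_char 1 x)))"
        "finite_measure L" "sets L = sets borel" for L
    proof -
      interpret L: finite_measure L by fact
      have i: "integrable L (\<lambda>x. \<phi> (circle_char 1 x) - g (circle_char 1 x))"
        using that by (simp add: complex_of_real_integrable_eq)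
      have "\<bar>(\<integral>x. \<phi> (circle_char 1 x) \<partial>L) - (\<integral>x. g (circle_char 1 x) \<partial>L)\<bar>
          = \<bar>\<integral>x. \<phi> (circle_char 1 x) - g (circle_char 1 x) \<partial>L\<bar>"
        using that by (simp add: complex_of_real_integrable_eq)
      also have "\<dots> \<le> (\<integral>x. \<bar>\<phi> (circle_char 1 x) - g (circle_char 1 x)\<bar> \<partial>L)"
        using integral_norm_bound[of L "\<lambda>x. \<phi> (circle_char 1 x) - g (circle_char 1 x)"] by simp
      also have "\<dots> \<le> (\<integral>x. e \<partial>L)"
        using i g(2) by (intro integral_mono) (auto intro: less_imp_le)
      also have "\<dots> = e * measure L UNIV"
        using sets_eq_imp_space_eq[OF that(4)] by simp
      finally show ?thesis .
    qed
    show ?thesis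
      using close[OF int(1) gint(1) fin(1) assms(3)] close[OF int(2) gint(2) fin(2) assms(4)] same
      by (simp add: distrib_left)
  qed
  then have "\<forall>\<^sub>F e in at_right 0. ?d \<le> e * (measure M UNIV + measure N UNIV)"
    by (simp add: eventually_at_filter)
  moreover have "((\<lambda>e. e * (measure M UNIV + measure N UNIV)) \<longlongrightarrow> 0 * (measure M UNIV + measure N UNIV)) (at_right 0)"
    by (intro tendsto_intros)
  ultimately have "?d \<le> 0 * (measure M UNIV + measure N UNIV)"
    by (intro tendsto_lowerbound) auto
  then show ?thesis by simp
qed

text \<open>The closed sets generate the Borel sets and are stable under intersection, so it suffices to compare
  the measures of a closed set. Its image \<open>K\<close> in the unit circle is closed, and its indicator function is
  the limit of the continuous functions \<open>max 0 (1 - n * infdist z K)\<close>.\<close>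

theorem measure_eq_if_fourier_coeffs_eq:
  assumes fin: "finite_measure M" "finite_measure N"
    and sets: "sets M = sets borel" "sets N = sets borel"
    and eq: "\<And>k. (\<integral>x. circle_char k x \<partial>M) = (\<integral>x. circle_char k x \<partial>N)"
  shows "M = N"
proof -
  have [measurable_cong]: "sets M = sets borel" "sets N = sets borel" by fact+
  interpret M: finite_measure M by fact
  interpret N: finite_measure N by fact
  have closed_eq: "emeasure M C = emeasure N C" if C: "closed C" for C
  proof (cases "C = {}")
    case False
    define K where "K = circle_char 1 ` C"
    have K: "closed K" "K \<noteq> {}"
      using closed_image_circle_char_1[OF C] False by (auto simp: K_def)
    have CK: "x \<in> C \<longleftrightarrow> circle_char 1 x \<in> K" for x
      using inj_circle_char_1 by (auto simp: K_def inj_def)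
    define \<phi> where "\<phi> n z = max 0 (1 - real n * infdist z K)" for n :: nat and z
    have cont: "continuous_on UNIV (\<phi> n)" for n
      unfolding \<phi>_def by (intro continuous_intros)
    have [measurable]: "\<phi> n \<in> borel_measurable borel" for n
      using cont by (rule borel_measurable_continuous_onI)
    have lim: "(\<lambda>n. \<phi> n (circle_char 1 x)) \<longlonglongrightarrow> indicator C x" for x
    proof (cases "x \<in> C")
      case True
      then show ?thesis by (simp add: \<phi>_def CK)
    next
      case False
      then have pos: "infdist (circle_char 1 x) K > 0"
        using K infdist_pos_not_in_closed by (auto simp: CK)
      obtain n0 where n0: "1 < real n0 * infdist (circle_char 1 x) K"
        using reals_Archimedean3[OF pos] by blast
      have "\<phi> n (circle_char 1 x) = 0" if "n \<ge> n0" for n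
      proof -
        have "real n0 * infdist (circle_char 1 x) K \<le> real n * infdist (circle_char 1 x) K"
          using that pos by (intro mult_right_mono) auto
        with n0 show ?thesis by (simp add: \<phi>_def)
      qed
      then show ?thesis
        using False by (intro tendsto_eventually) (auto simp: eventually_sequentially)
    qed
    have conv: "(\<lambda>n. \<integral>x. \<phi> n (circle_char 1 x) \<partial>L) \<longlonglongrightarrow> measure L C"
      if "finite_measure L" and [measurable_cong]: "sets L = sets borel" for L
    proof -
      interpret L: finite_measure L by fact
      have [measurable]: "C \<in> sets L" using C that by auto
      have bound: "\<bar>\<phi> n z\<bar> \<le> 1" for n z
        by (auto simp: \<phi>_def infdist_nonneg)
      have "(\<lambda>n. \<integral>x. \<phi> n (circle_char 1 x) \<partial>L) \<longlonglongrightarrow> (\<integral>x. indicator C x \<partial>L)"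
        by (rule integral_dominated_convergence[where w = "\<lambda>_. 1"]) (use lim bound in auto)
      then show ?thesis using sets.sets_into_space[OF \<open>C \<in> sets L\<close>] by (simp add: Int_absorb2)
    qed
    have "measure M C = measure N C"
      using conv[OF fin(1) sets(1)] conv[OF fin(2) sets(2)]
      unfolding integral_continuous_eq[OF fin sets eq cont]
      by (rule LIMSEQ_unique)
    then show ?thesis by (simp add: M.emeasure_eq_measure N.emeasure_eq_measure)
  qed simp
  show ?thesis
  proof (rule measure_eqI_generator_eq[where E = "Collect closed" and \<Omega> = UNIV and A = "\<lambda>_. UNIV"])
    show "Int_stable (Collect closed :: circle set set)"
      by (auto simp: Int_stable_def)
    show "sets M = sigma_sets UNIV (Collect closed)" "sets N = sigma_sets UNIV (Collect closed)"
      unfolding sets by (simp_all add: borel_eq_closed)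
  qed (use closed_eq in auto)
qed

section \<open>Lebesgue measure on the circle\<close>

lemma sets_lebesgue_circle [measurable_cong, simp]: "sets lebesgue_circle = sets borel"
  by (simp add: lebesgue_circle_def)

lemma measurable_abs_circle_restrict [measurable]:
  "abs_circle \<in> measurable (restrict_space lborel A) borel"
  by (rule measurable_restrict_space1) measurable

lemma prob_space_lebesgue_circle: "prob_space lebesgue_circle"
  unfolding lebesgue_circle_def
proof (rule prob_space.prob_space_distr)
  show "prob_space (restrict_space lborel {0..<1::real})"
    by (rule prob_spaceI) (simp add: emeasure_restrict_space)
qed measurable

lemma fourier_lebesgue_circle:
  "(\<integral>x. circle_char k x \<partial>lebesgue_circle) = (if k = 0 then 1 else 0)"
proof (cases "k = 0")
  case True
  interpret prob_space lebesgue_circle by (rule prob_space_lebesgue_circle)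
  show ?thesis using True prob_space by (simp add: circle_char_0[abs_def] cong: Bochner_Integration.integral_cong)
next
  case False
  let ?F = "\<lambda>x::real. cis (2 * pi * of_int k * x) / (2 * pi * \<i> * of_int k)"
  have "(\<integral>x. circle_char k x \<partial>lebesgue_circle)
      = (\<integral>x. indicator {0..<1} x *\<^sub>R cis (2 * pi * of_int k * x) \<partial>lborel)"
    unfolding lebesgue_circle_def
    by (subst integral_distr) (auto simp: integral_restrict_space circle_char.abs_eq)
  also have "\<dots> = (\<integral>x. indicator {0..1} x *\<^sub>R cis (2 * pi * of_int k * x) \<partial>lborel)"
  proof (rule integral_cong_AE)
    have [measurable]: "(\<lambda>x::real. cis (2 * pi * of_int k * x)) \<in> borel_measurable borel"
      by (intro borel_measurable_continuous_onI continuous_intros)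
    show "(\<lambda>x. indicator {0..<1} x *\<^sub>R cis (2 * pi * of_int k * x)) \<in> borel_measurable lborel"
      "(\<lambda>x. indicator {0..1} x *\<^sub>R cis (2 * pi * of_int k * x)) \<in> borel_measurable lborel"
      by measurable
    have "AE x in lborel. x \<noteq> (1::real)" by (rule AE_lborel_singleton)
    then show "AE x in lborel. indicator {0..<1} x *\<^sub>R cis (2 * pi * of_int k * x)
        = indicator {0..1} x *\<^sub>R cis (2 * pi * of_int k * x)"
      by eventually_elim (auto simp: indicator_def)
  qed
  also have "\<dots> = ?F 1 - ?F 0"
  proof (rule integral_FTC_Icc)
    show "(?F has_vector_derivative cis (2 * pi * of_int k * x)) (at x within {0..1})" for x
      using False
      by (auto simp: cis_conv_exp intro!: derivative_eq_intros has_vector_derivative_real_field)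
  qed (auto intro!: continuous_intros)
  also have "cis (2 * pi * of_int k * 1) = 1"
    using cis_multiple_2pi[of "of_int k"] by simp
  finally show ?thesis using False by simp
qed

lemma eq_lebesgue_circleI:
  assumes "finite_measure \<mu>" "sets \<mu> = sets borel"
    and "\<And>k. (\<integral>x. circle_char k x \<partial>\<mu>) = (if k = 0 then 1 else 0)"
  shows "\<mu> = lebesgue_circle"
  using assms prob_space.finite_measure[OF prob_space_lebesgue_circle]
  by (intro measure_eq_if_fourier_coeffs_eq) (auto simp: fourier_lebesgue_circle)

lemma singleton_circle_borel [measurable]: "{x :: circle} \<in> sets borel"
proof -
  have "{x} = circle_char 1 -` {circle_char 1 x} \<inter> space borel"
    using inj_circle_char_1 by (auto simp: inj_def)
  also have "\<dots> \<in> sets borel"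
    by measurable
  finally show ?thesis .
qed

lemma non_atomic_lebesgue_circle: "non_atomic lebesgue_circle"
  unfolding non_atomic_def
proof
  fix x
  obtain t where t: "x = abs_circle t" by (rule abs_circle_exhaust)
  let ?A = "abs_circle -` {x} \<inter> {0..<1}"
  have "?A \<subseteq> range (\<lambda>n::int. t + of_int n)"
  proof
    fix s assume "s \<in> ?A"
    then have "s - t \<in> \<int>" by (simp add: t circle.abs_eq_iff)
    then obtain n where "s - t = of_int n" by (elim Ints_cases)
    then have "s = t + of_int n" by simp
    then show "s \<in> range (\<lambda>n::int. t + of_int n)" by blast
  qed
  then have "countable ?A" by (rule countable_subset) simp
  then have "emeasure lborel ?A = 0" by (rule emeasure_lborel_countable)
  then show "measure lebesgue_circle {x} = 0"
    by (simp add: lebesgue_circle_def measure_def emeasure_distr emeasure_restrict_space space_restrict_space)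
qed

lemma times_invariant_iff:
  assumes "borel_probability \<mu>"
  shows "times_invariant q \<mu> \<longleftrightarrow> distr \<mu> \<mu> (times_map q) = \<mu>"
proof -
  interpret prob_space \<mu> using assms by (simp add: borel_probability_def)
  have sets [measurable_cong]: "sets \<mu> = sets borel" using assms by (simp add: borel_probability_def)
  have space: "space \<mu> = UNIV" using sets_eq_imp_space_eq[OF sets] by simp
  have emeas: "emeasure (distr \<mu> \<mu> (times_map q)) B = emeasure \<mu> (times_map q -` B)" if "B \<in> sets \<mu>" for B
    using that by (simp add: emeasure_distr space)
  show ?thesis
  proof
    assume inv: "times_invariant q \<mu>"
    show "distr \<mu> \<mu> (times_map q) = \<mu>"
      by (rule measure_eqI) (use inv sets in \<open>auto simp: emeas emeasure_eq_measure times_invariant_def\<close>)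
  next
    assume "distr \<mu> \<mu> (times_map q) = \<mu>"
    then show "times_invariant q \<mu>"
      using emeas sets by (auto simp: times_invariant_def emeasure_eq_measure)
  qed
qed

lemma borel_probability_lebesgue_circle: "borel_probability lebesgue_circle"
  by (simp add: borel_probability_def prob_space_lebesgue_circle)

lemma distr_lebesgue_circle:
  assumes [measurable]: "f \<in> measurable borel borel"
    and "\<And>k. (\<integral>x. circle_char k (f x) \<partial>lebesgue_circle) = (if k = 0 then 1 else 0)"
  shows "distr lebesgue_circle lebesgue_circle f = lebesgue_circle"
proof (rule eq_lebesgue_circleI)
  interpret prob_space lebesgue_circle by (rule prob_space_lebesgue_circle)
  show "finite_measure (distr lebesgue_circle lebesgue_circle f)"
    by (intro finite_measure_distr) measurable
qed (use assms(2) in \<open>auto simp: integral_distr\<close>)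

lemma times_invariant_lebesgue_circle:
  assumes "q \<noteq> 0"
  shows "times_invariant q lebesgue_circle"
  unfolding times_invariant_iff[OF borel_probability_lebesgue_circle]
  using assms by (intro distr_lebesgue_circle) (auto simp: circle_char_times_map fourier_lebesgue_circle)

lemma rotate_invariant_lebesgue_circle:
  "distr lebesgue_circle lebesgue_circle (circle_rotate a) = lebesgue_circle"
  by (intro distr_lebesgue_circle) (auto simp: circle_char_circle_rotate fourier_lebesgue_circle)

lemma times_map_rotate:
  assumes "q \<noteq> 0"
  shows "times_map q (circle_rotate (1 / of_int q) x) = times_map q x"
  using assms by transfer (simp add: distrib_left)

text \<open>Let \<open>B\<close> be an invariant set and \<open>c(k)\<close> the Fourier coefficients of its indicator function. Invariance
  under \<open>\<times>p\<close> gives \<open>c(k p) = c(k)\<close>. The indicator is also invariant under rotation by \<open>1 / p\<close>, which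
  \<open>\<times>p\<close> collapses, and this forces \<open>c(k) = 0\<close> unless \<open>p\<close> divides \<open>k\<close>. Dividing out \<open>p\<close>
  repeatedly shows \<open>c(k) = 0\<close> for all \<open>k \<noteq> 0\<close>. So the restriction of Lebesgue measure to \<open>B\<close> is a
  constant multiple of Lebesgue measure, and the complement of \<open>B\<close> tells which constants occur.\<close>

lemma times_ergodic_lebesgue_circle:
  assumes p: "p \<ge> 2"
  shows "times_ergodic p lebesgue_circle"
  unfolding times_ergodic_def
proof (intro ballI impI)
  fix B :: "circle set"
  assume B [measurable]: "B \<in> sets borel" and inv: "times_map p -` B = B"
  let ?L = lebesgue_circle
  interpret prob_space ?L by (rule prob_space_lebesgue_circle)
  have [simp]: "space ?L = UNIV"
    using sets_eq_imp_space_eq[OF sets_lebesgue_circle] by simp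
  define h :: "circle \<Rightarrow> real" where "h = indicator B"
  have h [measurable]: "h \<in> borel_measurable borel" unfolding h_def by simp
  have h_inv: "h (times_map p x) = h x" for x
    using inv by (auto simp: h_def indicator_def)
  define c where "c k = (\<integral>x. h x *\<^sub>R circle_char k x \<partial>?L)" for k
  have c_mult: "c (k * p) = c k" for k
  proof -
    have "c k = (\<integral>x. h x *\<^sub>R circle_char k x \<partial>distr ?L ?L (times_map p))"
      using times_invariant_lebesgue_circle[of p] p
      by (simp add: c_def times_invariant_iff[OF borel_probability_lebesgue_circle])
    also have "\<dots> = c (k * p)"
      by (subst integral_distr) (auto simp: c_def h_inv circle_char_times_map)
    finally show ?thesis by simp
  qed
  have c_ndvd: "c k = 0" if k: "\<not> p dvd k" for k
  proof -
    let ?a = "1 / real_of_int p"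
    let ?w = "cis (2 * pi * of_int k * ?a)"
    have h_rot: "h (circle_rotate ?a x) = h x" for x
      using h_inv[of "circle_rotate ?a x"] h_inv[of x] times_map_rotate[of p x] p by simp
    have "c k = (\<integral>x. h x *\<^sub>R circle_char k x \<partial>distr ?L ?L (circle_rotate ?a))"
      by (simp add: c_def rotate_invariant_lebesgue_circle)
    also have "\<dots> = (\<integral>x. ?w * (h x *\<^sub>R circle_char k x) \<partial>?L)"
      by (subst integral_distr) (auto simp: h_rot circle_char_circle_rotate)
    also have "\<dots> = ?w * c k"
      unfolding c_def by (rule integral_mult_right_zero)
    finally have "(1 - ?w) * c k = 0" by (simp add: algebra_simps)
    moreover have "?w \<noteq> 1"
    proof
      assume "?w = 1"
      then have "of_int k * ?a \<in> \<int>"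
        using circle_char_eq_1_iff[of k ?a] by (simp add: circle_char.abs_eq)
      then obtain n where "of_int k * ?a = of_int n" by (elim Ints_cases)
      then have "real_of_int k = real_of_int (p * n)"
        using p by (simp add: field_simps)
      then have "k = p * n" by (simp only: of_int_eq_iff)
      with k show False by simp
    qed
    ultimately show ?thesis by simp
  qed
  have c_0: "c k = 0" if "k \<noteq> 0" for k
    using that
  proof (induction "nat \<bar>k\<bar>" arbitrary: k rule: less_induct)
    case less
    show ?case
    proof (cases "p dvd k")
      case True
      then obtain l where l: "k = l * p" by (metis dvd_div_mult_self)
      have "\<bar>k\<bar> = \<bar>l\<bar> * p" "l \<noteq> 0" using l p less.prems by (auto simp: abs_mult)
      moreover have "\<bar>l\<bar> * 1 < \<bar>l\<bar> * p" using \<open>l \<noteq> 0\<close> p by (intro mult_strict_left_mono) auto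
      ultimately show ?thesis using less.hyps[of l] by (simp add: l c_mult)
    qed (rule c_ndvd)
  qed
  define b where "b = prob B"
  have b: "c 0 = of_real b"
    using sets.sets_into_space[of B ?L]
    by (simp add: c_def h_def b_def scaleR_conv_of_real Int_absorb2)
  have fin: "finite_measure (density ?L (\<lambda>x. ennreal (g x)))"
    if [measurable]: "g \<in> borel_measurable borel" and g: "\<And>x. g x \<le> 1" for g
  proof (rule finite_measureI)
    have "emeasure (density ?L (\<lambda>x. ennreal (g x))) (space (density ?L (\<lambda>x. ennreal (g x))))
        = (\<integral>\<^sup>+x. ennreal (g x) \<partial>?L)"
      by (subst emeasure_density) (auto intro!: nn_integral_cong simp: indicator_def)
    also have "\<dots> \<le> (\<integral>\<^sup>+x. 1 \<partial>?L)"
      using g by (intro nn_integral_mono) (simp add: ennreal_le_1)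
    also have "\<dots> = 1"
      using emeasure_space_1 by simp
    finally show "emeasure (density ?L (\<lambda>x. ennreal (g x))) (space (density ?L (\<lambda>x. ennreal (g x)))) \<noteq> \<infinity>"
      using ennreal_one_less_top by (auto simp: top_unique)
  qed
  \<comment> \<open>Restricted to \<open>B\<close>, Lebesgue measure has the Fourier coefficients of \<open>b\<close> times Lebesgue measure.\<close>
  have eq: "density ?L h = density ?L (\<lambda>_. b)"
  proof (rule measure_eq_if_fourier_coeffs_eq)
    show "finite_measure (density ?L (\<lambda>x. ennreal (h x)))" "finite_measure (density ?L (\<lambda>x. ennreal b))"
      by (auto intro!: fin simp: h_def b_def indicator_def)
    fix k
    show "(\<integral>x. circle_char k x \<partial>density ?L (\<lambda>x. ennreal (h x)))
        = (\<integral>x. circle_char k x \<partial>density ?L (\<lambda>x. ennreal b))"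
      using c_0[of k] b
      by (subst (1 2) integral_density) (auto simp: c_def h_def b_def fourier_lebesgue_circle scaleR_conv_of_real)
  qed auto
  have "emeasure (density ?L h) (- B) = (\<integral>\<^sup>+x. ennreal (h x) * indicator (- B) x \<partial>?L)"
    by (rule emeasure_density) auto
  also have "(\<lambda>x. ennreal (h x) * indicator (- B) x) = (\<lambda>x. 0)"
    by (auto simp: h_def indicator_def)
  finally have "emeasure (density ?L h) (- B) = (\<integral>\<^sup>+x. 0 \<partial>?L)" .
  then have "0 = emeasure (density ?L h) (- B)"
    by simp
  also have "\<dots> = ennreal b * emeasure ?L (- B)"
    unfolding eq by (rule emeasure_density_const) simp
  also have "emeasure ?L (- B) = ennreal (1 - b)"
    using prob_compl[of B] by (simp add: emeasure_eq_measure b_def Compl_eq_Diff_UNIV)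
  also have "ennreal b * ennreal (1 - b) = ennreal (b * (1 - b))"
    by (simp add: b_def ennreal_mult)
  finally have "b * (1 - b) \<le> 0"
    by (metis ennreal_eq_0_iff)
  moreover have "0 \<le> b * (1 - b)"
    by (simp add: b_def)
  ultimately have "b * (1 - b) = 0"
    by linarith
  then show "(measure ?L B)\<^sup>2 = measure ?L B"
    by (simp add: b_def power2_eq_square algebra_simps)
qed

section \<open>Rigidity\<close>

text \<open>A mean value 1 of a function with values in the unit disc forces the value 1 almost everywhere, and
  \<open>e\<^sub>k(x) = 1\<close> only for the finitely many \<open>x\<close> with \<open>k x \<in> \<int>\<close>.\<close>

lemma non_atomic_fourier_coeff_ne_1:
  assumes "borel_probability \<mu>" "non_atomic \<mu>" "k \<noteq> 0"
  shows "(\<integral>x. circle_char k x \<partial>\<mu>) \<noteq> 1"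
proof
  interpret prob_space \<mu> using assms by (simp add: borel_probability_def)
  have [measurable_cong]: "sets \<mu> = sets borel" using assms by (simp add: borel_probability_def)
  assume 1: "(\<integral>x. circle_char k x \<partial>\<mu>) = 1"
  have int: "integrable \<mu> (circle_char k)"
    by (rule integrable_const_bound[where B = 1]) auto
  have Re_le: "Re (circle_char k x) \<le> 1" for x
    using complex_Re_le_cmod[of "circle_char k x"] by simp
  have "(\<integral>x. 1 - Re (circle_char k x) \<partial>\<mu>) = 0"
    using 1 int by (simp add: prob_space)
  then have "AE x in \<mu>. 1 - Re (circle_char k x) = 0"
    using int Re_le by (subst (asm) integral_nonneg_eq_0_iff_AE) auto
  then have "AE x in \<mu>. circle_char k x = 1"
  proof eventually_elim
    case (elim x)
    then show ?case using cmod_power2[of "circle_char k x"] by (auto simp: complex_eq_iff)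
  qed
  moreover
  let ?Z = "range (\<lambda>n::int. abs_circle (of_int n / of_int k))"
  have "x \<in> ?Z" if "circle_char k x = 1" for x
  proof -
    obtain t where t: "x = abs_circle t" by (rule abs_circle_exhaust)
    then obtain n where "of_int k * t = of_int n"
      using \<open>circle_char k x = 1\<close> by (auto simp: circle_char_eq_1_iff elim: Ints_cases)
    then have "t = of_int n / of_int k" using \<open>k \<noteq> 0\<close> by (simp add: field_simps)
    then show ?thesis unfolding t by blast
  qed
  ultimately have "AE x in \<mu>. x \<in> ?Z" by (auto elim: eventually_mono)
  moreover have "AE x in \<mu>. x \<notin> ?Z"
  proof (rule AE_not_in)
    have "{x} \<in> null_sets \<mu>" for x
      using assms by (auto simp: null_sets_def non_atomic_def emeasure_eq_measure borel_probability_def)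
    then have "(\<Union>x\<in>?Z. {x}) \<in> null_sets \<mu>"
      by (intro null_sets_UN') auto
    then show "?Z \<in> null_sets \<mu>" by simp
  qed
  ultimately have "AE x in \<mu>. False" by eventually_elim simp
  then show False by simp
qed

text \<open>On a block \<open>{a..<a + m}\<close> of exponents, invariance turns \<open>u = u(k)\<close> into the integral of a Birkhoff
  average of \<open>e\<^sub>k\<close>, evaluated at \<open>p\<^sup>a x\<close>, times \<open>e\<^sub>k\<close>. Replacing that average by its limit \<open>u\<close> costs
  at most its mean distance \<open>r m\<close> to \<open>u\<close>, which is independent of \<open>a\<close>. Therefore
  \<open>|u - u\<^sup>2| \<le> r m\<close> for every \<open>m \<ge> 1\<close>.\<close>

theorem lebesgue_if_invariant_on_blocks:
  assumes \<mu>: "borel_probability \<mu>" "non_atomic \<mu>"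
    and p: "times_invariant p \<mu>" "times_ergodic p \<mu>"
    and blocks: "\<And>m. \<exists>a. \<forall>j\<in>{a..<a + m}. times_invariant (p ^ j + 1) \<mu>"
  shows "\<mu> = lebesgue_circle"
proof -
  interpret prob_space \<mu> using \<mu> by (simp add: borel_probability_def)
  have sets [measurable_cong]: "sets \<mu> = sets borel" using \<mu> by (simp add: borel_probability_def)
  have space: "space \<mu> = UNIV" using sets_eq_imp_space_eq[OF sets] by simp
  interpret ergodic_map \<mu> "times_map p"
  proof
    show "times_map p \<in> measurable \<mu> \<mu>" by measurable
    show "distr \<mu> \<mu> (times_map p) = \<mu>" using p \<mu> by (simp add: times_invariant_iff)
    show "prob B = 0 \<or> prob B = 1" if "B \<in> events" "times_map p -` B \<inter> space \<mu> = B" for B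
    proof -
      have "(prob B)\<^sup>2 = prob B"
        using that p sets unfolding times_ergodic_def by (simp add: space)
      then show ?thesis by (simp add: power2_eq_square)
    qed
  qed
  have zero: "(\<integral>x. circle_char k x \<partial>\<mu>) = 0" if "k \<noteq> 0" for k
  proof -
    let ?f = "circle_char k"
    define u where "u = (\<integral>x. ?f x \<partial>\<mu>)"
    have int_f: "integrable \<mu> ?f"
      by (rule integrable_const_bound[where B = 1]) auto
    define r where "r m = (\<integral>x. norm (birkhoff_avg ?f m x - u) \<partial>\<mu>)" for m
    have r: "r \<longlonglongrightarrow> 0"
      unfolding r_def u_def by (rule mean_ergodic_L1[where C = 1]) auto
    have bound: "norm (u - u * u) \<le> r m" if m: "m \<ge> 1" for m
    proof -
      obtain a where a: "\<And>j. j \<in> {a..<a + m} \<Longrightarrow> times_invariant (p ^ j + 1) \<mu>"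
        using blocks by blast
      let ?g = "\<lambda>x. birkhoff_avg ?f m ((times_map p ^^ a) x)"
      have int_g: "integrable \<mu> (\<lambda>x. ?g x * ?f x)"
        by (rule integrable_const_bound[where B = 1])
           (auto simp: norm_mult intro!: AE_I2 norm_birkhoff_avg_le)
      have coeff: "(\<integral>x. ?f ((times_map p ^^ j) x) * ?f x \<partial>\<mu>) = u" if "j \<in> {a..<a + m}" for j
      proof -
        have "u = (\<integral>x. ?f x \<partial>distr \<mu> \<mu> (times_map (p ^ j + 1)))"
          using a[OF that] \<mu> by (simp add: u_def times_invariant_iff)
        also have "\<dots> = (\<integral>x. ?f ((times_map p ^^ j) x) * ?f x \<partial>\<mu>)"
          by (subst integral_distr)
             (auto simp: times_map_funpow circle_char_times_map circle_char_add[symmetric] algebra_simps)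
        finally show ?thesis ..
      qed
      have "(\<integral>x. ?g x * ?f x \<partial>\<mu>)
          = (\<integral>x. (\<Sum>i<m. ?f ((times_map p ^^ (a + i)) x) * ?f x) /\<^sub>R real m \<partial>\<mu>)"
        by (simp add: birkhoff_avg_def sum_distrib_right flip: funpow_add[THEN fun_cong, unfolded o_def] add: add.commute)
      also have "\<dots> = (\<Sum>i<m. \<integral>x. ?f ((times_map p ^^ (a + i)) x) * ?f x \<partial>\<mu>) /\<^sub>R real m"
        by (subst integral_scaleR_right, subst Bochner_Integration.integral_sum)
           (auto simp: norm_mult intro!: integrable_const_bound[where B = 1])
      also have "\<dots> = u"
        using m by (simp add: coeff scaleR_conv_of_real)
      finally have avg: "(\<integral>x. ?g x * ?f x \<partial>\<mu>) = u" .
      have "u - u * u = (\<integral>x. (?g x - u) * ?f x \<partial>\<mu>)"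
        using int_f int_g by (simp add: left_diff_distrib avg flip: u_def)
      also have "norm \<dots> \<le> (\<integral>x. norm ((?g x - u) * ?f x) \<partial>\<mu>)"
        by (rule integral_norm_bound)
      also have "\<dots> = (\<integral>x. norm (?g x - u) \<partial>\<mu>)"
        by (simp add: norm_mult)
      also have "\<dots> = r m"
        unfolding r_def by (rule integral_funpow) measurable
      finally show ?thesis .
    qed
    have "norm (u - u * u) \<le> 0"
      by (rule LIMSEQ_le_const[OF r]) (use bound in blast)
    then have "u = 0 \<or> u = 1" by (simp add: algebra_simps)
    then show ?thesis
      using non_atomic_fourier_coeff_ne_1[OF \<mu> that] by (simp add: u_def)
  qed
  show ?thesis
  proof (rule eq_lebesgue_circleI)
    show "finite_measure \<mu>" by unfold_locales
    show "(\<integral>x. circle_char k x \<partial>\<mu>) = (if k = 0 then 1 else 0)" for k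
      using zero[of k] prob_space by (simp add: circle_char_0[abs_def] cong: Bochner_Integration.integral_cong)
  qed (rule sets)
qed

section \<open>Sparse multiplicative semigroups\<close>

text \<open>Products of one or more generators: the empty product 1 is left out, so that the semigroup generated by
  \<open>p\<close> alone consists of the positive powers of \<open>p\<close>.\<close>

inductive_set generated_semigroup :: "nat set \<Rightarrow> nat set" for G where
  gen: "g \<in> G \<Longrightarrow> g \<in> generated_semigroup G"
| mult: "a \<in> generated_semigroup G \<Longrightarrow> b \<in> generated_semigroup G \<Longrightarrow> a * b \<in> generated_semigroup G"

lemma generated_semigroup_pos:
  assumes "0 \<notin> G" "x \<in> generated_semigroup G"
  shows "x \<ge> 1"
  using assms(2)
proof induction
  case (gen g)
  then show ?case using assms(1) by (cases g) auto
qed auto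

lemma mult_semigroup_generated:
  assumes "0 \<notin> G"
  shows "mult_semigroup (generated_semigroup G)"
  using generated_semigroup_pos[OF assms] by (auto simp: mult_semigroup_def intro: generated_semigroup.mult)

lemma factors_le:
  fixes a b n :: nat
  assumes "a * b \<le> n" "a \<ge> 1" "b \<ge> 1"
  shows "a \<le> n" "b \<le> n"
proof -
  have "a * 1 \<le> a * b" "1 * b \<le> a * b"
    using assms by (intro mult_le_mono order_refl; simp)+
  with assms(1) show "a \<le> n" "b \<le> n" by linarith+
qed

lemma generated_semigroup_exponents:
  assumes G: "0 \<notin> G" and x: "x \<in> generated_semigroup G" "x \<le> n"
  shows "\<exists>e. x = (\<Prod>g\<in>G \<inter> {..n}. g ^ e g)"
  using x
proof (induction)
  case (gen g)
  have "(\<Prod>h\<in>G \<inter> {..n}. h ^ (if h = g then 1 else 0)) = (\<Prod>h\<in>G \<inter> {..n}. if h = g then h else 1)"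
    by (intro prod.cong) auto
  also have "\<dots> = g"
    using gen by (simp add: prod.delta)
  finally show ?case by metis
next
  case (mult a b)
  have "a \<le> n" "b \<le> n"
    using factors_le[OF mult.prems] generated_semigroup_pos[OF G] mult.hyps by auto
  with mult.IH obtain d e where "a = (\<Prod>g\<in>G \<inter> {..n}. g ^ d g)" "b = (\<Prod>g\<in>G \<inter> {..n}. g ^ e g)"
    by blast
  then have "a * b = (\<Prod>g\<in>G \<inter> {..n}. g ^ (d g + e g))"
    by (simp add: power_add prod.distrib)
  then show ?case by (rule exI[of _ "\<lambda>g. d g + e g"])
qed

text \<open>An element up to \<open>n\<close> is determined by the exponents of the generators up to \<open>n\<close>. As every generator
  is at least \<open>p\<close>, an exponent \<open>e\<close> that occurs satisfies \<open>p\<^sup>e \<le> n\<close>.\<close>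

lemma card_generated_semigroup_le:
  assumes p: "p \<ge> 1" "\<And>g. g \<in> G \<Longrightarrow> g \<ge> p" and K: "\<And>e. p ^ e \<le> n \<Longrightarrow> e \<le> K"
  shows "card (generated_semigroup G \<inter> {1..n}) \<le> (K + 1) ^ card (G \<inter> {..n})"
proof -
  let ?Gn = "G \<inter> {..n}"
  have G: "0 \<notin> G" using p by fastforce
  have "generated_semigroup G \<inter> {1..n} \<subseteq> (\<lambda>e. \<Prod>g\<in>?Gn. g ^ e g) ` (PiE ?Gn (\<lambda>_. {..K}))"
  proof
    fix x assume x: "x \<in> generated_semigroup G \<inter> {1..n}"
    then obtain e where e: "x = (\<Prod>g\<in>?Gn. g ^ e g)"
      using generated_semigroup_exponents[OF G, of x n] by auto
    have "e g \<le> K" if g: "g \<in> ?Gn" for g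
    proof (rule K)
      have "p ^ e g \<le> g ^ e g" using p(2)[of g] g by (intro power_mono) auto
      also have "\<dots> \<le> x"
      proof (rule dvd_imp_le)
        show "g ^ e g dvd x" unfolding e using g by (intro dvd_prodI) auto
      qed (use x in auto)
      finally show "p ^ e g \<le> n" using x by simp
    qed
    then show "x \<in> (\<lambda>e. \<Prod>g\<in>?Gn. g ^ e g) ` (PiE ?Gn (\<lambda>_. {..K}))"
      by (intro image_eqI[of _ _ "restrict e ?Gn"]) (auto simp: e intro!: prod.cong)
  qed
  then have "card (generated_semigroup G \<inter> {1..n}) \<le> card (PiE ?Gn (\<lambda>_. {..K}))"
    by (rule surj_card_le[rotated]) (simp add: finite_PiE)
  also have "\<dots> = (K + 1) ^ card ?Gn"
    by (simp add: card_PiE)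
  finally show ?thesis .
qed

lemma generated_semigroup_powers:
  assumes G: "0 \<notin> G" "G \<inter> {..n} \<subseteq> {p}" and x: "x \<in> generated_semigroup G" "x \<le> n"
  shows "\<exists>k\<ge>1. x = p ^ k"
  using x
proof induction
  case (gen g)
  then have "g = p ^ 1" using G by auto
  then show ?case by blast
next
  case (mult a b)
  have "a \<le> n" "b \<le> n"
    using factors_le[OF mult.prems] generated_semigroup_pos[OF G(1)] mult.hyps by auto
  with mult.IH obtain k l where "k \<ge> 1" "a = p ^ k" "b = p ^ l"
    by blast
  then have "k + l \<ge> 1 \<and> a * b = p ^ (k + l)"
    by (simp add: power_add)
  then show ?case by blast
qed

text \<open>The \<open>m\<close>-th block of exponents is \<open>{a m..<a m + m}\<close>, with \<open>a m\<close> so large that \<open>\<tau>\<close> is, from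
  \<open>p ^ a m\<close> on, at least twice the number \<open>1 + (0 + 1 + \<dots> + m)\<close> of generators coming from \<open>p\<close> and the
  blocks up to \<open>m\<close>. If \<open>M\<close> is the last block reached by \<open>n\<close>, at most \<open>1 + (0 + \<dots> + M)\<close>
  generators lie below \<open>n\<close>, each with at most \<open>L + 1 \<le> L\<^sup>2\<close> possible exponents, where \<open>L = log p n\<close>. The
  factor two pays for this square.\<close>

theorem exists_sparse_semigroup_with_blocks:
  fixes p :: nat and \<tau> :: "nat \<Rightarrow> real"
  assumes p: "p \<ge> 2" and \<tau>: "filterlim \<tau> at_top sequentially"
  obtains S where "mult_semigroup S" "p \<in> S"
    "\<And>n. n \<ge> 1 \<Longrightarrow> attainable p \<tau> n \<Longrightarrow> real (card (S \<inter> {1..n})) \<le> log (real p) (real n) powr \<tau> n"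
    "\<And>m. \<exists>a. \<forall>j\<in>{a..<a + m}. p ^ j + 1 \<in> S"
proof -
  \<comment> \<open>\<open>a \<ge> m\<close> leaves only finitely many blocks below \<open>n\<close>, and \<open>a \<ge> 2\<close> ensures \<open>L \<ge> 2\<close>.\<close>
  have "\<exists>a. a \<ge> m \<and> a \<ge> 2 \<and> (\<forall>n\<ge>p ^ a. real (2 * (1 + (\<Sum>i\<le>m. i))) \<le> \<tau> n)" for m :: nat
  proof -
    obtain N where N: "\<And>n. n \<ge> N \<Longrightarrow> real (2 * (1 + (\<Sum>i\<le>m. i))) \<le> \<tau> n"
      using \<tau> unfolding filterlim_at_top eventually_sequentially by blast
    let ?a = "max N (max m 2)"
    have "?a < p ^ ?a" using p by (intro power_gt_expt) auto
    then show ?thesis using N by (intro exI[of _ ?a]) auto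
  qed
  then obtain a where a: "\<And>m. a m \<ge> m" "\<And>m. a m \<ge> 2"
    and a_\<tau>: "\<And>m n. p ^ a m \<le> n \<Longrightarrow> real (2 * (1 + (\<Sum>i\<le>m. i))) \<le> \<tau> n"
    by metis
  define A where "A = (\<Union>m. {a m..<a m + m})"
  define G where "G = insert p ((\<lambda>j. p ^ j + 1) ` A)"
  have G_ge: "g \<ge> p" if "g \<in> G" for g
  proof -
    have "p \<le> p ^ j + 1" if "j \<in> A" for j
    proof -
      from that obtain m where "j \<ge> a m" by (auto simp: A_def)
      then have "j \<ge> 1" using a(2)[of m] by linarith
      then have "p ^ 1 \<le> p ^ j" using p by (intro power_increasing) auto
      then show ?thesis by simp
    qed
    with that show ?thesis by (auto simp: G_def)
  qed
  have G0: "0 \<notin> G" using G_ge p by fastforce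
  show thesis
  proof (rule that)
    show "mult_semigroup (generated_semigroup G)" by (rule mult_semigroup_generated[OF G0])
    show "p \<in> generated_semigroup G" by (rule generated_semigroup.gen) (simp add: G_def)
    show "\<exists>a. \<forall>j\<in>{a..<a + m}. p ^ j + 1 \<in> generated_semigroup G" for m
      by (intro exI[of _ "a m"]) (auto intro!: generated_semigroup.gen simp: G_def A_def)
  next
    fix n :: nat
    assume n: "n \<ge> 1" and att: "attainable p \<tau> n"
    define X where "X = {m. p ^ a m \<le> n}"
    have G_sub: "G \<inter> {..n} \<subseteq> insert p ((\<lambda>j. p ^ j + 1) ` (\<Union>m\<in>X. {a m..<a m + m}))"
    proof
      fix g assume g: "g \<in> G \<inter> {..n}"
      show "g \<in> insert p ((\<lambda>j. p ^ j + 1) ` (\<Union>m\<in>X. {a m..<a m + m}))"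
      proof (cases "g = p")
        case False
        with g obtain m j where j: "j \<in> {a m..<a m + m}" "g = p ^ j + 1"
          by (auto simp: G_def A_def)
        have "p ^ a m \<le> p ^ j" using j p by (intro power_increasing) auto
        then have "m \<in> X" using j g by (simp add: X_def)
        with j show ?thesis by blast
      qed simp
    qed
    show "real (card (generated_semigroup G \<inter> {1..n})) \<le> log (real p) (real n) powr \<tau> n"
    proof (cases "X = {}")
      case True
      \<comment> \<open>No generator besides \<open>p\<close> is in reach.\<close>
      then have "generated_semigroup G \<inter> {1..n} \<subseteq> {p ^ k |k. k \<ge> 1} \<inter> {1..n}"
        using generated_semigroup_powers[OF G0, of n p] G_sub by fastforce
      then have "card (generated_semigroup G \<inter> {1..n}) \<le> card ({p ^ k |k. k \<ge> 1} \<inter> {1..n})"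
        by (intro card_mono) auto
      with att show ?thesis by (simp add: attainable_def)
    next
      case False
      have X_le: "m \<le> n" if "m \<in> X" for m
      proof -
        have "a m < p ^ a m" using p by (intro power_gt_expt) auto
        with that a(1)[of m] show ?thesis by (simp add: X_def)
      qed
      then have "finite X" by (intro finite_subset[of X "{..n}"]) auto
      define M where "M = Max X"
      have M: "M \<in> X" "\<And>m. m \<in> X \<Longrightarrow> m \<le> M"
        using \<open>finite X\<close> False by (auto simp: M_def)
      let ?s = "\<Sum>i\<le>M. i"
      define L where "L = log p n"
      have "p ^ 2 \<le> p ^ a M" using p a(2)[of M] by (intro power_increasing) auto
      also have "\<dots> \<le> n" using M(1) by (simp add: X_def)
      finally have "real p ^ 2 \<le> real n" by (metis of_nat_le_iff of_nat_power)
      then have L2: "L \<ge> 2"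
        using p n by (simp add: L_def le_log_iff powr_numeral)
      have "card (G \<inter> {..n}) \<le> card (insert p ((\<lambda>j. p ^ j + 1) ` (\<Union>m\<in>X. {a m..<a m + m})))"
        using G_sub \<open>finite X\<close> by (intro card_mono) auto
      also have "\<dots> \<le> Suc (card ((\<lambda>j. p ^ j + 1) ` (\<Union>m\<in>X. {a m..<a m + m})))"
        by (rule card_insert_le_m1) auto
      also have "\<dots> \<le> Suc (card (\<Union>m\<in>X. {a m..<a m + m}))"
        using \<open>finite X\<close> by (simp add: card_image_le)
      also have "card (\<Union>m\<in>X. {a m..<a m + m}) \<le> (\<Sum>m\<in>X. card {a m..<a m + m})"
        using \<open>finite X\<close> by (rule card_UN_le)
      also have "\<dots> \<le> ?s"
        using M(2) by (auto intro!: sum_mono2)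
      finally have card_G: "card (G \<inter> {..n}) \<le> 1 + ?s" by simp
      define K where "K = nat \<lfloor>L\<rfloor>"
      have K: "e \<le> K" if "p ^ e \<le> n" for e
      proof -
        have "real p ^ e \<le> real n" using that by (metis of_nat_le_iff of_nat_power)
        then have "real e \<le> L" using p n by (simp add: L_def le_log_iff powr_realpow)
        then show ?thesis by (simp add: K_def le_nat_floor)
      qed
      have "card (generated_semigroup G \<inter> {1..n}) \<le> (K + 1) ^ card (G \<inter> {..n})"
        by (rule card_generated_semigroup_le[of p]) (use p G_ge K in auto)
      also have "\<dots> \<le> (K + 1) ^ (1 + ?s)"
        using card_G by (intro power_increasing) auto
      finally have "real (card (generated_semigroup G \<inter> {1..n})) \<le> real ((K + 1) ^ (1 + ?s))"
        by (simp only: of_nat_le_iff)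
      also have "\<dots> = (real K + 1) ^ (1 + ?s)"
        by (simp only: of_nat_power of_nat_add of_nat_1)
      also have "\<dots> \<le> (L ^ 2) ^ (1 + ?s)"
      proof (rule power_mono)
        have "real K \<le> L" using L2 by (simp add: K_def)
        moreover have "L * 2 \<le> L * L" using L2 by (intro mult_left_mono) auto
        ultimately show "real K + 1 \<le> L ^ 2"
          unfolding power2_eq_square using L2 by linarith
      qed simp
      also have "\<dots> = L powr real (2 * (1 + ?s))"
        using powr_realpow[of L "2 * (1 + ?s)"] L2 by (simp only: power_mult)
      also have "\<dots> \<le> L powr \<tau> n"
        using L2 a_\<tau>[of M n] M(1) by (intro powr_mono) (auto simp: X_def)
      finally show ?thesis by (simp add: L_def)
    qed
  qed
qed

section \<open>Sparse semigroups that single out Lebesgue measure\<close>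

lemma only_lebesgueI:
  assumes p: "p \<ge> 2" and S: "mult_semigroup S"
    and blocks: "\<And>m. \<exists>a. \<forall>j\<in>{a..<a + m}. p ^ j + 1 \<in> S"
  shows "only_lebesgue p S"
  unfolding only_lebesgue_def
proof (intro allI iffI)
  fix \<mu>
  assume \<mu>: "borel_probability \<mu> \<and> non_atomic \<mu> \<and> times_invariant (int p) \<mu> \<and>
    times_ergodic (int p) \<mu> \<and> (\<forall>q\<in>S. times_invariant (int q) \<mu>)"
  have "\<exists>a. \<forall>j\<in>{a..<a + m}. times_invariant (int p ^ j + 1) \<mu>" for m
  proof -
    obtain a where a: "\<forall>j\<in>{a..<a + m}. p ^ j + 1 \<in> S" using blocks by blast
    have "times_invariant (int p ^ j + 1) \<mu>" if "j \<in> {a..<a + m}" for j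
    proof -
      have "times_invariant (int (p ^ j + 1)) \<mu>" using a \<mu> that by blast
      then show ?thesis by (simp add: add.commute)
    qed
    then show ?thesis by blast
  qed
  then show "\<mu> = lebesgue_circle"
    using \<mu> by (intro lebesgue_if_invariant_on_blocks) auto
next
  fix \<mu>
  assume [simp]: "\<mu> = lebesgue_circle"
  have "times_invariant (int q) \<mu>" if "q \<in> S" for q
    using that S by (auto simp: mult_semigroup_def intro!: times_invariant_lebesgue_circle)
  then show "borel_probability \<mu> \<and> non_atomic \<mu> \<and> times_invariant (int p) \<mu> \<and>
    times_ergodic (int p) \<mu> \<and> (\<forall>q\<in>S. times_invariant (int q) \<mu>)"
    using p by (simp add: borel_probability_lebesgue_circle non_atomic_lebesgue_circle
      times_invariant_lebesgue_circle times_ergodic_lebesgue_circle)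
qed

text \<open>The logarithm of the bound is \<open>sqrt (ln n) * ln (log p n)\<close>, which is negligible against \<open>ln n\<close>.
  Since \<open>sqrt (ln n) \<ge> 1\<close> for large \<open>n\<close>, the bound is eventually attainable.\<close>

lemma log_card_ratio_tendsto_0:
  fixes p :: nat
  assumes p: "p \<ge> 2" "p \<in> S"
    and bound: "\<And>n. n \<ge> 1 \<Longrightarrow> attainable p (\<lambda>n. sqrt (ln (real n))) n \<Longrightarrow>
      real (card (S \<inter> {1..n})) \<le> log (real p) (real n) powr sqrt (ln (real n))"
  shows "(\<lambda>n. ln (real (card (S \<inter> {1..n}))) / ln (real n)) \<longlonglongrightarrow> 0"
proof (rule tendsto_sandwich[of "\<lambda>_. 0"])
  define c where "c = ln (real p)"
  have c: "c > 0" using p by (simp add: c_def)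
  let ?bound = "\<lambda>n::nat. sqrt (ln (real n)) * ln (ln (real n) / c) / ln (real n)"
  have large: "\<forall>\<^sub>F n in sequentially. n \<ge> p \<and> ln (real n) \<ge> 1"
  proof (rule eventually_conj)
    show "\<forall>\<^sub>F n in sequentially. ln (real n) \<ge> 1" by real_asymp
  qed (rule eventually_ge_at_top)
  have card_ge: "card (S \<inter> {1..n}) \<ge> 1" if "n \<ge> p" for n
  proof -
    have "p \<in> S \<inter> {1..n}" using p that by auto
    then have "0 < card (S \<inter> {1..n})" by (subst card_gt_0_iff) blast
    then show ?thesis by linarith
  qed
  show "\<forall>\<^sub>F n in sequentially. 0 \<le> ln (real (card (S \<inter> {1..n}))) / ln (real n)"
    using large
  proof eventually_elim
    case (elim n)
    with card_ge[of n] show ?case by simp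
  qed
  show "\<forall>\<^sub>F n in sequentially. ln (real (card (S \<inter> {1..n}))) / ln (real n) \<le> ?bound n"
    using large
  proof eventually_elim
    case (elim n)
    have n: "n \<ge> 2" using elim p by simp
    have att: "attainable p (\<lambda>n. sqrt (ln (real n))) n"
      using elim n p by (intro attainable_if_ge_1) auto
    have L: "log p n > 0" using n p by simp
    have "ln (real (card (S \<inter> {1..n}))) \<le> ln (log p n powr sqrt (ln n))"
      using bound[OF _ att] card_ge[of n] elim n L by (intro ln_mono) auto
    also have "\<dots> = sqrt (ln n) * ln (ln n / c)"
      using L by (simp add: ln_powr log_def c_def)
    finally show ?case using elim by (intro divide_right_mono) auto
  qed
  show "?bound \<longlonglongrightarrow> 0" using c by real_asymp
qed auto

theorem theorem5p3:
  fixes p :: nat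
  assumes "p \<ge> 2"
  shows "(\<forall>\<tau> :: nat \<Rightarrow> real. mono_on {1..} \<tau> \<and> filterlim \<tau> at_top sequentially \<longrightarrow>
           (\<exists>S. mult_semigroup S \<and> p \<in> S \<and>
              (\<forall>n\<ge>1. attainable p \<tau> n \<longrightarrow>
                 real (card (S \<inter> {1..n})) \<le> log (real p) (real n) powr \<tau> n) \<and>
              only_lebesgue p S))
       \<and> (\<exists>S. mult_semigroup S \<and> p \<in> S \<and>
              (\<lambda>n. ln (real (card (S \<inter> {1..n}))) / ln (real n)) \<longlonglongrightarrow> 0 \<and>
              only_lebesgue p S)"
proof (intro conjI allI impI)
  fix \<tau> :: "nat \<Rightarrow> real"
  assume "mono_on {1..} \<tau> \<and> filterlim \<tau> at_top sequentially"
  then obtain S where "mult_semigroup S" "p \<in> S"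
    "\<And>n. n \<ge> 1 \<Longrightarrow> attainable p \<tau> n \<Longrightarrow> real (card (S \<inter> {1..n})) \<le> log (real p) (real n) powr \<tau> n"
    "\<And>m. \<exists>a. \<forall>j\<in>{a..<a + m}. p ^ j + 1 \<in> S"
    using exists_sparse_semigroup_with_blocks[OF assms] by blast
  then show "\<exists>S. mult_semigroup S \<and> p \<in> S \<and>
      (\<forall>n\<ge>1. attainable p \<tau> n \<longrightarrow>
         real (card (S \<inter> {1..n})) \<le> log (real p) (real n) powr \<tau> n) \<and>
      only_lebesgue p S"
    using only_lebesgueI[OF assms] by blast
next
  have "filterlim (\<lambda>n. sqrt (ln (real n))) at_top sequentially" by real_asymp
  then obtain S where "mult_semigroup S" "p \<in> S"
    "\<And>n. n \<ge> 1 \<Longrightarrow> attainable p (\<lambda>n. sqrt (ln (real n))) n \<Longrightarrow>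
       real (card (S \<inter> {1..n})) \<le> log (real p) (real n) powr sqrt (ln (real n))"
    "\<And>m. \<exists>a. \<forall>j\<in>{a..<a + m}. p ^ j + 1 \<in> S"
    using exists_sparse_semigroup_with_blocks[OF assms] by blast
  then show "\<exists>S. mult_semigroup S \<and> p \<in> S \<and>
      (\<lambda>n. ln (real (card (S \<inter> {1..n}))) / ln (real n)) \<longlonglongrightarrow> 0 \<and>
      only_lebesgue p S"
    using only_lebesgueI[OF assms] log_card_ratio_tendsto_0[OF assms] by blast
qed

end
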